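(* Let $X$ and $Y$ be infinite Tychonoff spaces. Then: (1) If the space $X\times Y$ is pseudocompact, then $C_p(X\times Y)$ contains a complemented copy of $(c_0)_p$. (2) If the space $X\times Y$ is not pseudocompact, then $C_p(X\times Y)$ contains a complemented copy of $\mathbb{R}^{\omega}$.
   Context: For a Tychonoff space $Z$, $C_p(Z)$ is the vector space of all continuous real-valued functions on $Z$ with the topology of pointwise convergence. $Z$ is pseudocompact if every continuous real-valued function on $Z$ is bounded. $(c_0)_p=\{(x_n)_{n\in\omega}\in\mathbb{R}^\omega: x_n\to 0\}$ with the topology inherited from the product topology of $\mathbb{R}^\omega$; $\mathbb{R}^\omega$ carries the product topology. A topological vector space $E$ contains a complemented copy of $F$ if there is a linear subspace $Z_0\subset E$ linearly homeomorphic to $F$ and a continuous linear projection of $E$ onto $Z_0$. *)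

theory Defs
  imports "HOL-Analysis.Analysis" "HOL-Library.Function_Algebras"
begin

instantiation "fun" :: (type, real_vector) real_vector
begin

definition scaleR_fun :: "real \<Rightarrow> ('a \<Rightarrow> 'b) \<Rightarrow> 'a \<Rightarrow> 'b"
  where "scaleR_fun c f = (\<lambda>x. c *\<^sub>R f x)"

instance
  by standard (simp_all add: scaleR_fun_def fun_eq_iff scaleR_add_right scaleR_add_left)

end

lemma scaleR_fun_apply [simp]: "(c *\<^sub>R f) x = c *\<^sub>R f x"
  by (simp add: scaleR_fun_def)

definition Tychonoff_space :: "'a topology \<Rightarrow> bool"
  where "Tychonoff_space X \<longleftrightarrow> completely_regular_space X \<and> Hausdorff_space X"

definition pseudocompact_space :: "'a topology \<Rightarrow> bool"
  where "pseudocompact_space X \<longleftrightarrow>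
    (\<forall>f. continuous_map X euclideanreal f \<longrightarrow> bounded (f ` topspace X))"

text \<open>A topological vector space is represented by a topology whose carrier is a linear
  subspace of an ambient real vector space; the linear operations are those of the ambient
  space. Linearity of maps is required on the carrier only.\<close>

definition linear_map_on :: "'a::real_vector set \<Rightarrow> ('a \<Rightarrow> 'b::real_vector) \<Rightarrow> bool"
  where "linear_map_on V h \<longleftrightarrow>
    (\<forall>x\<in>V. \<forall>y\<in>V. h (x + y) = h x + h y) \<and> (\<forall>c. \<forall>x\<in>V. h (c *\<^sub>R x) = c *\<^sub>R h x)"

definition linearly_homeomorphic ::
    "'a::real_vector topology \<Rightarrow> 'b::real_vector topology \<Rightarrow> bool"
  where "linearly_homeomorphic E F \<longleftrightarrow>
    (\<exists>h. linear_map_on (topspace E) h \<and> homeomorphic_map E F h)"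

definition continuous_linear_projection ::
    "'a::real_vector topology \<Rightarrow> 'a set \<Rightarrow> ('a \<Rightarrow> 'a) \<Rightarrow> bool"
  where "continuous_linear_projection E Z P \<longleftrightarrow>
    linear_map_on (topspace E) P \<and> continuous_map E E P \<and>
    P ` topspace E = Z \<and> (\<forall>x\<in>topspace E. P (P x) = P x)"

definition contains_complemented_copy ::
    "'a::real_vector topology \<Rightarrow> 'b::real_vector topology \<Rightarrow> bool"
  where "contains_complemented_copy E F \<longleftrightarrow>
    (\<exists>Z. subspace Z \<and> Z \<subseteq> topspace E \<and>
      linearly_homeomorphic (subtopology E Z) F \<and>
      (\<exists>P. continuous_linear_projection E Z P))"

text \<open>A function on the space \<open>X\<close> is represented by its extension by zero to the whole
  type, so that functions on \<open>X\<close> form a linear subspace of \<^typ>\<open>'a \<Rightarrow> real\<close>. The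
  coordinates outside \<open>topspace X\<close> are constantly zero and do not affect the product topology;
  \<open>Cp_restrict_homeomorphic\<close> below confirms this.\<close>

definition Cp :: "'a topology \<Rightarrow> ('a \<Rightarrow> real) topology"
  where "Cp X = subtopology (powertop_real UNIV)
    {f. continuous_map X euclideanreal f \<and> (\<forall>x. x \<notin> topspace X \<longrightarrow> f x = 0)}"

definition c0p :: "(nat \<Rightarrow> real) topology"
  where "c0p = subtopology (powertop_real UNIV) {x. x \<longlonglongrightarrow> 0}"

abbreviation Romega :: "(nat \<Rightarrow> real) topology"
  where "Romega \<equiv> powertop_real UNIV"

lemma topspace_Cp:
  "topspace (Cp X) = {f. continuous_map X euclideanreal f \<and> (\<forall>x. x \<notin> topspace X \<longrightarrow> f x = 0)}"
  by (simp add: Cp_def)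

lemma topspace_c0p: "topspace c0p = {x. x \<longlonglongrightarrow> 0}"
  by (simp add: c0p_def)

lemma subspace_topspace_Cp: "subspace (topspace (Cp X))"
  unfolding topspace_Cp subspace_def
  by (auto simp: zero_fun_def plus_fun_def scaleR_fun_def
      intro!: continuous_map_add continuous_map_real_mult_left)

lemma subspace_topspace_c0p: "subspace (topspace c0p)"
  unfolding topspace_c0p subspace_def
  by (auto simp: zero_fun_def plus_fun_def scaleR_fun_def
      intro: tendsto_add_zero tendsto_mult_right_zero)

lemma Cp_restrict_homeomorphic:
  "homeomorphic_map (Cp X)
     (subtopology (powertop_real (topspace X)) {f. continuous_map X euclideanreal f})
     (\<lambda>f. restrict f (topspace X))"
proof -
  let ?S = "topspace X"
  let ?T = "subtopology (powertop_real ?S) {f. continuous_map X euclideanreal f}"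
  let ?r = "\<lambda>f. restrict f ?S"
  let ?e = "\<lambda>f x. if x \<in> ?S then f x else (0::real)"
  have cont: "continuous_map X euclideanreal g"
    if "continuous_map X euclideanreal f" "\<And>x. x \<in> ?S \<Longrightarrow> g x = f x" for f g
    using that continuous_map_eq by metis
  have "continuous_map (Cp X) ?T ?r"
    unfolding continuous_map_in_subtopology
  proof
    show "continuous_map (Cp X) (powertop_real ?S) ?r"
      unfolding continuous_map_componentwise Cp_def
      by (auto intro!: continuous_map_from_subtopology continuous_map_product_projection)
    show "?r \<in> topspace (Cp X) \<rightarrow> {f. continuous_map X euclideanreal f}"
      by (auto simp: topspace_Cp intro: cont)
  qed
  moreover have "continuous_map ?T (Cp X) ?e"
    unfolding Cp_def continuous_map_in_subtopology
  proof
    show "continuous_map ?T (powertop_real UNIV) ?e"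
      unfolding continuous_map_componentwise_UNIV
    proof
      fix k show "continuous_map ?T euclideanreal (\<lambda>f. if k \<in> ?S then f k else 0)"
        by (cases "k \<in> ?S")
          (auto intro!: continuous_map_from_subtopology continuous_map_product_projection)
    qed
    show "?e \<in> topspace ?T \<rightarrow>
      {f. continuous_map X euclideanreal f \<and> (\<forall>x. x \<notin> ?S \<longrightarrow> f x = 0)}"
      by (auto intro: cont)
  qed
  ultimately have "homeomorphic_maps (Cp X) ?T ?r ?e"
    by (auto simp: homeomorphic_maps_def topspace_Cp fun_eq_iff PiE_def extensional_def)
  then show ?thesis
    using homeomorphic_maps_map by blast
qed

end

theory Submission
  imports Defs
begin

text \<open>
  Both copies are split by biorthogonal systems: functions \<open>g\<^sub>n\<close> with pairwise disjoint supports
  and finitely supported measures \<open>\<mu>\<^sub>n\<close> with \<open>\<mu>\<^sub>n(g\<^sub>m) = \<delta>\<^sub>n\<^sub>m\<close>, so that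
  \<open>f \<mapsto> \<Sum>\<^sub>n \<mu>\<^sub>n(f) g\<^sub>n\<close> is the projection. If the product carries an unbounded continuous
  \<open>f\<close>, take point masses at points where \<open>\<bar>f\<bar>\<close> grows fast, and bumps that depend on \<open>\<bar>f\<bar>\<close> only; these
  are locally finite, hence every coefficient sequence is allowed.

  If the product is pseudocompact, \<open>\<mu>\<^sub>n\<close> is the average over a block of \<open>2\<^sup>n\<close> points of
  \<open>X\<close> (one for each sign pattern) and \<open>n\<close> points of \<open>Y\<close>, weighted by the signs. On a function
  \<open>c(y)\<close> of the second variable alone, orthogonality of the signs and Cauchy-Schwarz bound even the
  average of the absolute values of the rows by \<open>\<parallel>c\<parallel> / \<surd>n\<close>. By
  pseudocompactness the sections \<open>f(x, \<sqdot>)\<close> form a uniformly totally bounded family, so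
  finitely many such \<open>c\<close> suffice up to \<open>\<epsilon>\<close>, and \<open>\<mu>\<^sub>n(f) \<rightarrow> 0\<close>. This replaces Glicksberg's theorem on
  \<open>\<beta>(X \<times> Y)\<close> followed by Stone-Weierstrass.
\<close>

section \<open>Real-valued continuous maps\<close>

lemma continuous_map_real_iff:
  fixes f :: "'a \<Rightarrow> real"
  shows "continuous_map X euclideanreal f \<longleftrightarrow>
    (\<forall>x\<in>topspace X. \<forall>e>0. \<exists>U. openin X U \<and> x \<in> U \<and> (\<forall>y\<in>U. \<bar>f y - f x\<bar> < e))"
  using Met_TC.continuous_map_to_metric[of X f]
  by (auto simp: dist_real_def abs_minus_commute Met_TC.in_mball)

text \<open>Continuity of every infinite sum below rests on this: locally finite sums agree with a
  finite sum near each point, and combinations with null coefficients are uniformly close to one.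
  The approximant \<open>h\<close> may change with both the point and \<open>e\<close>.\<close>

lemma continuous_map_locally_uniform_limit:
  fixes g :: "'a \<Rightarrow> real"
  assumes "\<And>x e. x \<in> topspace X \<Longrightarrow> e > 0 \<Longrightarrow>
    \<exists>U h. openin X U \<and> x \<in> U \<and> continuous_map X euclideanreal h \<and> (\<forall>y\<in>U. \<bar>g y - h y\<bar> \<le> e)"
  shows "continuous_map X euclideanreal g"
  unfolding continuous_map_real_iff
proof (intro ballI allI impI)
  fix x and e :: real assume x: "x \<in> topspace X" and e: "e > 0"
  obtain U h where U: "openin X U" "x \<in> U" "continuous_map X euclideanreal h"
      "\<And>y. y \<in> U \<Longrightarrow> \<bar>g y - h y\<bar> \<le> e/3"
    using assms[OF x, of "e/3"] e by auto
  obtain V where V: "openin X V" "x \<in> V" "\<And>y. y \<in> V \<Longrightarrow> \<bar>h y - h x\<bar> < e/3"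
    using U(3) x e unfolding continuous_map_real_iff by (metis divide_pos_pos zero_less_numeral)
  have "\<bar>g y - g x\<bar> < e" if "y \<in> U \<inter> V" for y
  proof -
    have "\<bar>g y - h y\<bar> \<le> e/3" "\<bar>g x - h x\<bar> \<le> e/3" "\<bar>h y - h x\<bar> < e/3"
      using U(2,4) V(3) that by blast+
    then show ?thesis by linarith
  qed
  then show "\<exists>U. openin X U \<and> x \<in> U \<and> (\<forall>y\<in>U. \<bar>g y - g x\<bar> < e)"
    using U V by (intro exI[of _ "U \<inter> V"]) auto
qed

lemma bump_function_exists:
  assumes "completely_regular_space X" "openin X U" "p \<in> U"
  obtains \<phi> :: "'a \<Rightarrow> real" where "continuous_map X euclideanreal \<phi>" "\<phi> p = 1"
    "\<And>u. 0 \<le> \<phi> u" "\<And>u. \<phi> u \<le> 1" "\<And>u. u \<notin> U \<Longrightarrow> \<phi> u = 0"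
proof -
  have "closedin X (topspace X - U)" "p \<in> topspace X - (topspace X - U)"
    using assms openin_subset by fastforce+
  then obtain f :: "'a \<Rightarrow> real" where f: "continuous_map X (top_of_set {0..1}) f" "f p = 0"
      "f ` (topspace X - U) \<subseteq> {1}"
    using assms(1) unfolding completely_regular_space_def by meson
  have fc: "continuous_map X euclideanreal f" and f01: "\<And>u. u \<in> topspace X \<Longrightarrow> f u \<in> {0..1}"
    using f(1) by (auto simp: continuous_map_in_subtopology)
  \<comment> \<open>Zero off \<open>topspace X\<close> is the encoding used by \<open>Cp\<close>; it
    also makes the bounds hold on the whole type.\<close>
  define \<phi> where "\<phi> u = (if u \<in> topspace X then 1 - f u else 0)" for u
  have "continuous_map X euclideanreal (\<lambda>u. 1 - f u)"
    using fc by (intro continuous_intros) auto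
  then have "continuous_map X euclideanreal \<phi>"
    by (rule continuous_map_eq) (simp add: \<phi>_def)
  moreover have "p \<in> topspace X" using assms openin_subset by blast
  ultimately show thesis
    using f f01 by (intro that[of \<phi>]) (auto simp: \<phi>_def image_subset_iff)
qed

section \<open>Disjointly supported families and bump sequences\<close>

lemma suminf_eq_single:
  fixes F :: "nat \<Rightarrow> real"
  assumes "\<And>n. n \<noteq> k \<Longrightarrow> F n = 0"
  shows "suminf F = F k"
  using suminf_finite[of "{k}" F] assms by simp

text \<open>The index \<open>k\<close> is chosen from \<open>G\<close> before any \<open>v\<close>.
  Hence, at a fixed point, a disjointly supported series is a multiple of one fixed coordinate of
  \<open>v\<close>, which later gives linearity and pointwise continuity in
  \<open>v\<close>.\<close>

lemma suminf_disjoint_eq: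
  fixes G :: "nat \<Rightarrow> real"
  assumes "\<And>n m. G n \<noteq> 0 \<Longrightarrow> G m \<noteq> 0 \<Longrightarrow> n = m"
  obtains k where "\<And>v :: nat \<Rightarrow> real. (\<Sum>n. v n * G n) = v k * G k" "\<And>n. n \<noteq> k \<Longrightarrow> G n = 0"
proof -
  obtain k where "\<And>n. n \<noteq> k \<Longrightarrow> G n = 0" using assms by (cases "\<exists>k. G k \<noteq> 0") blast+
  then show thesis by (intro that[of k] suminf_eq_single) auto
qed

text \<open>If all points are isolated, singletons serve. Otherwise nonempty open sets are peeled
  off shrinking neighbourhoods of a non-isolated point \<open>p\<close>.\<close>

lemma infinite_Hausdorff_disjoint_open_sets:
  assumes "Hausdorff_space X" "infinite (topspace X)"
  obtains U :: "nat \<Rightarrow> 'a set" where "\<And>n. openin X (U n)" "\<And>n. U n \<noteq> {}"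
    "\<And>n m. n \<noteq> m \<Longrightarrow> U n \<inter> U m = {}"
proof (cases "\<forall>p\<in>topspace X. openin X {p}")
  case True
  obtain p :: "nat \<Rightarrow> 'a" where "inj p" "range p \<subseteq> topspace X"
    using assms(2) infinite_countable_subset by blast
  then show thesis using True by (intro that[of "\<lambda>n. {p n}"]) (auto simp: inj_eq)
next
  case False
  then obtain p where p: "p \<in> topspace X" "\<not> openin X {p}" by blast
  define P where "P UW \<longleftrightarrow> openin X (fst UW) \<and> openin X (snd UW) \<and> fst UW \<noteq> {} \<and> p \<in> snd UW
    \<and> fst UW \<inter> snd UW = {}" for UW
  \<comment> \<open>As \<open>p\<close> is not isolated, \<open>W\<close> contains some
    \<open>q\<close> other than \<open>p\<close>. Separating the two gives an open piece to keep
    (\<open>fst\<close>) and a smaller neighbourhood of \<open>p\<close> to continue in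
    (\<open>snd\<close>).\<close>
  have split: "\<exists>UW. P UW \<and> fst UW \<subseteq> W \<and> snd UW \<subseteq> W" if W: "openin X W" "p \<in> W" for W
  proof -
    obtain q where q: "q \<in> W" "q \<noteq> p" using W p by (metis empty_iff insertI1 openin_subopen singletonD subsetI)
    obtain A B where "openin X A" "openin X B" "q \<in> A" "p \<in> B" "disjnt A B"
      using assms(1) q p W openin_subset unfolding Hausdorff_space_def by (metis subsetD)
    then show ?thesis using W q
      by (intro exI[of _ "(A \<inter> W, B \<inter> W)"]) (auto simp: P_def disjnt_def)
  qed
  have "\<exists>F. \<forall>n. P (F n) \<and> (fst (F (Suc n)) \<subseteq> snd (F n) \<and> snd (F (Suc n)) \<subseteq> snd (F n))"
  proof (rule dependent_nat_choice[of "\<lambda>_. P" "\<lambda>_ A B. fst B \<subseteq> snd A \<and> snd B \<subseteq> snd A"])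
    show "\<exists>x. P x" using split[of "topspace X"] p by blast
    show "\<exists>y. P y \<and> fst y \<subseteq> snd x \<and> snd y \<subseteq> snd x" if "P x" for x
      using split[of "snd x"] that by (auto simp: P_def)
  qed
  then obtain F where F: "\<And>n. P (F n)" "\<And>n. fst (F (Suc n)) \<subseteq> snd (F n)"
      "\<And>n. snd (F (Suc n)) \<subseteq> snd (F n)" by blast
  have mono: "snd (F m) \<subseteq> snd (F n)" if "n \<le> m" for n m
    using lift_Suc_antimono_le[of "\<lambda>n. snd (F n)"] F(3) that by blast
  have disj: "fst (F n) \<inter> fst (F m) = {}" if less: "n < m" for n m
  proof -
    obtain k where "m = Suc k" "n \<le> k" using less by (cases m) auto
    then have "fst (F m) \<subseteq> snd (F n)" using F(2) mono by blast
    then show ?thesis using F(1)[of n] by (auto simp: P_def)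
  qed
  then have "fst (F n) \<inter> fst (F m) = {}" if "n \<noteq> m" for n m
    using that by (metis Int_commute nat_neq_iff)
  with F(1) show thesis by (intro that[of "\<lambda>n. fst (F n)"]) (auto simp: P_def)
qed

lemma Tychonoff_bump_sequence:
  assumes "Tychonoff_space X" "infinite (topspace X)"
  obtains x :: "nat \<Rightarrow> 'a" and \<phi> :: "nat \<Rightarrow> 'a \<Rightarrow> real"
  where "\<And>k. x k \<in> topspace X" "\<And>k. continuous_map X euclideanreal (\<phi> k)"
    "\<And>k. \<phi> k (x k) = 1" "\<And>k u. 0 \<le> \<phi> k u" "\<And>k u. \<phi> k u \<le> 1"
    "\<And>k u. u \<notin> topspace X \<Longrightarrow> \<phi> k u = 0"
    "\<And>k l u. \<phi> k u \<noteq> 0 \<Longrightarrow> \<phi> l u \<noteq> 0 \<Longrightarrow> k = l"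
proof -
  have X: "completely_regular_space X" "Hausdorff_space X"
    using assms by (auto simp: Tychonoff_space_def)
  obtain U :: "nat \<Rightarrow> 'a set" where U: "\<And>n. openin X (U n)" "\<And>n. U n \<noteq> {}"
      "\<And>n m. n \<noteq> m \<Longrightarrow> U n \<inter> U m = {}"
    using infinite_Hausdorff_disjoint_open_sets X(2) assms(2) by blast
  define x where "x n = (SOME p. p \<in> U n)" for n
  have x: "x n \<in> U n" for n unfolding x_def using U(2) by (simp add: some_in_eq)
  have "\<forall>n. \<exists>f::'a \<Rightarrow> real. continuous_map X euclideanreal f \<and> f (x n) = 1 \<and> (\<forall>u. 0 \<le> f u)
      \<and> (\<forall>u. f u \<le> 1) \<and> (\<forall>u. u \<notin> U n \<longrightarrow> f u = 0)"
    by (metis bump_function_exists[OF X(1) U(1) x])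
  then obtain \<phi> :: "nat \<Rightarrow> 'a \<Rightarrow> real" where \<phi>: "\<And>n. continuous_map X euclideanreal (\<phi> n)"
    "\<And>n. \<phi> n (x n) = 1" "\<And>n u. 0 \<le> \<phi> n u" "\<And>n u. \<phi> n u \<le> 1" "\<And>n u. u \<notin> U n \<Longrightarrow> \<phi> n u = 0"
    by metis
  have sub: "U n \<subseteq> topspace X" for n using U(1) openin_subset by blast
  show thesis
  proof (rule that[of x \<phi>])
    show "k = l" if "\<phi> k u \<noteq> 0" "\<phi> l u \<noteq> 0" for k l u
      using that \<phi>(5) U(3) by (metis IntI empty_iff)
  qed (use x sub \<phi> in blast)+
qed

section \<open>Pseudocompact products\<close>

text \<open>If every point had a neighbourhood meeting at most one \<open>G n\<close>, bumps inside
  the \<open>G n\<close> with weights \<open>n\<close> would add up to a continuous function,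
  locally a single term, with value \<open>n\<close> at a point of \<open>G n\<close>. That function
  is unbounded.\<close>

lemma pseudocompact_no_discrete_open_sequence:
  fixes G :: "nat \<Rightarrow> 'a set"
  assumes "pseudocompact_space Z" "completely_regular_space Z"
    and G: "\<And>n. openin Z (G n)" "\<And>n. G n \<noteq> {}"
  obtains z where "z \<in> topspace Z"
    "\<And>O'. openin Z O' \<Longrightarrow> z \<in> O' \<Longrightarrow> \<exists>n m. n < m \<and> G n \<inter> O' \<noteq> {} \<and> G m \<inter> O' \<noteq> {}"
proof (rule ccontr)
  assume neg: "\<not> thesis"
  note cluster = that
  have disc: "\<exists>O'. openin Z O' \<and> z \<in> O' \<and> (\<forall>n m. n < m \<longrightarrow> G n \<inter> O' = {} \<or> G m \<inter> O' = {})"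
    if "z \<in> topspace Z" for z using that neg cluster[OF that] by blast
  define p where "p n = (SOME p. p \<in> G n)" for n
  have p: "p n \<in> G n" for n unfolding p_def using G(2) by (simp add: some_in_eq)
  have "\<forall>n. \<exists>f::'a \<Rightarrow> real. continuous_map Z euclideanreal f \<and> f (p n) = 1 \<and> (\<forall>u. u \<notin> G n \<longrightarrow> f u = 0)"
    by (metis bump_function_exists[OF assms(2) G(1) p])
  then obtain \<phi> :: "nat \<Rightarrow> 'a \<Rightarrow> real" where \<phi>: "\<And>n. continuous_map Z euclideanreal (\<phi> n)"
    "\<And>n. \<phi> n (p n) = 1" "\<And>n u. u \<notin> G n \<Longrightarrow> \<phi> n u = 0"
    by metis
  have one: "\<exists>O' k. openin Z O' \<and> z \<in> O' \<and> (\<forall>u\<in>O'. \<forall>n. n \<noteq> k \<longrightarrow> \<phi> n u = 0)" if z: "z \<in> topspace Z" for z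
  proof -
    obtain O' where O': "openin Z O'" "z \<in> O'" "\<And>n m. n < m \<Longrightarrow> G n \<inter> O' = {} \<or> G m \<inter> O' = {}"
      using disc[OF z] by blast
    obtain k where "\<And>n. n \<noteq> k \<Longrightarrow> G n \<inter> O' = {}"
      using O'(3) by (cases "\<exists>k. G k \<inter> O' \<noteq> {}") (metis nat_neq_iff, blast)
    then have "\<phi> n u = 0" if "u \<in> O'" "n \<noteq> k" for n u using \<phi>(3) that by blast
    then show ?thesis using O'(1,2) by blast
  qed
  define h where "h u = (\<Sum>n. real n * \<phi> n u)" for u
  have "continuous_map Z euclideanreal h"
  proof (rule continuous_map_locally_uniform_limit)
    fix z and e :: real assume z: "z \<in> topspace Z" and e: "e > 0"
    obtain O' k where O': "openin Z O'" "z \<in> O'" "\<And>u n. u \<in> O' \<Longrightarrow> n \<noteq> k \<Longrightarrow> \<phi> n u = 0"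
      using one[OF z] by blast
    have "h u = real k * \<phi> k u" if "u \<in> O'" for u
      unfolding h_def by (rule suminf_eq_single) (simp add: O'(3)[OF that])
    then show "\<exists>U f. openin Z U \<and> z \<in> U \<and> continuous_map Z euclideanreal f \<and> (\<forall>y\<in>U. \<bar>h y - f y\<bar> \<le> e)"
      using O' e \<phi>(1) by (intro exI[of _ O'] exI[of _ "\<lambda>u. real k * \<phi> k u"])
        (auto intro!: continuous_map_real_mult_left)
  qed
  then have "bounded (h ` topspace Z)" using assms(1) by (auto simp: pseudocompact_space_def)
  then obtain B where B: "\<And>u. u \<in> topspace Z \<Longrightarrow> \<bar>h u\<bar> \<le> B"
    unfolding bounded_iff by auto
  have pz: "p n \<in> topspace Z" for n using p G(1) openin_subset by blast
  have "h (p n) = real n" for n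
  proof -
    obtain O' k where "p n \<in> O'" "\<And>u n. u \<in> O' \<Longrightarrow> n \<noteq> k \<Longrightarrow> \<phi> n u = 0"
      using one[OF pz[of n]] by blast
    \<comment> \<open>The one index \<open>k\<close> allowed near \<open>p n\<close> must be
      \<open>n\<close>, because \<open>\<phi> n (p n) = 1\<close>.\<close>
    then have "\<phi> m (p n) = 0" if "m \<noteq> n" for m using \<phi>(2)[of n] that by (metis zero_neq_one)
    then show ?thesis unfolding h_def using \<phi>(2) by (subst suminf_eq_single[of n]) auto
  qed
  then have "real n \<le> B" for n using B[OF pz[of n]] by simp
  moreover obtain n where "B < real n" using reals_Archimedean2 by blast
  ultimately show False by (metis not_le)
qed

lemma continuous_map_prod_real_nbhd:
  fixes f :: "'a \<times> 'b \<Rightarrow> real"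
  assumes "continuous_map (prod_topology X Y) euclideanreal f" "x \<in> topspace X" "y \<in> topspace Y" "e > 0"
  obtains U V where "openin X U" "openin Y V" "x \<in> U" "y \<in> V"
    "\<And>x' y'. x' \<in> U \<Longrightarrow> y' \<in> V \<Longrightarrow> \<bar>f (x', y') - f (x, y)\<bar> < e"
proof -
  have "(x, y) \<in> topspace (prod_topology X Y)" using assms by simp
  then obtain W where W: "openin (prod_topology X Y) W" "(x, y) \<in> W" "\<And>z. z \<in> W \<Longrightarrow> \<bar>f z - f (x, y)\<bar> < e"
    using assms(1,4) unfolding continuous_map_real_iff by metis
  then obtain U V where "openin X U" "openin Y V" "x \<in> U" "y \<in> V" "U \<times> V \<subseteq> W"
    unfolding openin_prod_topology_alt by meson
  with W show thesis by (intro that[of U V]) auto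
qed

text \<open>Failure at \<open>x0\<close> produces boxes \<open>U n \<times> V n\<close> on which the
  section differs clearly from the one at \<open>x0\<close>, while all later \<open>U m\<close> lie
  so close to \<open>x0\<close> that over \<open>V n\<close> the difference is small. A point whose
  neighbourhoods always meet two of the boxes contradicts continuity there.\<close>

lemma pseudocompact_prod_equicontinuous_sections:
  fixes f :: "'a \<times> 'b \<Rightarrow> real"
  assumes "pseudocompact_space (prod_topology X Y)" "completely_regular_space (prod_topology X Y)"
    and f: "continuous_map (prod_topology X Y) euclideanreal f"
    and x0: "x0 \<in> topspace X" and e: "e > 0"
  obtains U where "openin X U" "x0 \<in> U"
    "\<And>x y. x \<in> U \<Longrightarrow> y \<in> topspace Y \<Longrightarrow> \<bar>f (x, y) - f (x0, y)\<bar> < e"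
proof (rule ccontr)
  assume neg: "\<not> thesis"
  note found = that
  \<comment> \<open>The deviation from the section at \<open>x0\<close>; it vanishes on the fibre
    over \<open>x0\<close>.\<close>
  define g where "g z = \<bar>f z - f (x0, snd z)\<bar>" for z
  have "continuous_map (prod_topology X Y) (prod_topology X Y) (\<lambda>z. (x0, snd z))"
    using x0 by (auto simp: continuous_map_pairwise o_def intro: continuous_map_snd)
  from continuous_map_compose[OF this f]
  have g: "continuous_map (prod_topology X Y) euclideanreal g"
    unfolding g_def using f by (intro continuous_intros) (auto simp: o_def)
  \<comment> \<open>The states are triples \<open>(U, V, W)\<close>: \<open>g\<close> is large on \<open>U \<times> V\<close> and small on
    \<open>W \<times> V\<close>, and the later sets \<open>U\<close> are taken inside \<open>W\<close>.\<close>
  define P where "P = (\<lambda>(U, V, W). openin X U \<and> openin Y V \<and> openin X W \<and> U \<noteq> {} \<and> V \<noteq> {} \<and> x0 \<in> W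
     \<and> (\<forall>x\<in>U. \<forall>y\<in>V. g (x, y) > 2 * e / 3) \<and> (\<forall>x\<in>W. \<forall>y\<in>V. g (x, y) < e / 3))"
  define Q where "Q = (\<lambda>(U :: 'a set, V :: 'b set, W :: 'a set) (U' :: 'a set, V' :: 'b set, W'). U' \<subseteq> W \<and> W' \<subseteq> W)"
  have step: "\<exists>U V W'. P (U, V, W') \<and> U \<subseteq> W \<and> W' \<subseteq> W" if W: "openin X W" "x0 \<in> W" for W
  proof -
    obtain x y where xy: "x \<in> W" "y \<in> topspace Y" "e \<le> g (x, y)"
      using neg found[OF W] unfolding g_def by (metis not_less snd_conv)
    have x: "x \<in> topspace X" using xy W openin_subset by blast
    have e3: "e / 3 > 0" using e by simp
    obtain U V where UV: "openin X U" "openin Y V" "x \<in> U" "y \<in> V"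
      "\<And>x' y'. x' \<in> U \<Longrightarrow> y' \<in> V \<Longrightarrow> \<bar>g (x', y') - g (x, y)\<bar> < e / 3"
      using continuous_map_prod_real_nbhd[OF g x xy(2) e3] by metis
    obtain A B where AB: "openin X A" "openin Y B" "x0 \<in> A" "y \<in> B"
      "\<And>x' y'. x' \<in> A \<Longrightarrow> y' \<in> B \<Longrightarrow> \<bar>g (x', y') - g (x0, y)\<bar> < e / 3"
      using continuous_map_prod_real_nbhd[OF g x0 xy(2) e3] by metis
    have g0: "g (x0, y) = 0" by (simp add: g_def)
    have "g (x', y') > 2 * e / 3" if "x' \<in> U" "y' \<in> V" for x' y'
      using UV(5)[OF that] xy(3) by linarith
    moreover have "g (x', y') < e / 3" if "x' \<in> A" "y' \<in> B" for x' y'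
      using AB(5)[OF that] g0 by linarith
    moreover have "x \<in> U \<inter> W" "y \<in> V \<inter> B" "x0 \<in> A \<inter> W"
      using UV(3,4) AB(3,4) W xy(1) by auto
    ultimately have "P (U \<inter> W, V \<inter> B, A \<inter> W)"
      using UV(1,2) AB(1,2) W(1) unfolding P_def by auto
    then show ?thesis by blast
  qed
  have "\<exists>F. \<forall>n. P (F n) \<and> Q (F n) (F (Suc n))"
  proof (rule dependent_nat_choice[of "\<lambda>_. P" "\<lambda>_. Q"])
    show "\<exists>x. P x" using step[of "topspace X"] x0 by blast
    show "\<exists>y. P y \<and> Q x y" if "P x" for x
    proof -
      obtain U V W where x: "x = (U, V, W)" by (cases x)
      then have "openin X W" "x0 \<in> W" using that by (auto simp: P_def)
      then obtain U' V' W' where "P (U', V', W')" "U' \<subseteq> W" "W' \<subseteq> W" using step by blast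
      then show ?thesis unfolding x by (intro exI[of _ "(U', V', W')"]) (simp add: Q_def)
    qed
  qed
  then obtain F where F: "\<And>n. P (F n)" "\<And>n. Q (F n) (F (Suc n))" by blast
  define U V W where "U n = fst (F n)" and "V n = fst (snd (F n))" and "W n = snd (snd (F n))" for n
  have FP: "openin X (U n)" "openin Y (V n)" "U n \<noteq> {}" "V n \<noteq> {}"
    "\<And>x y. x \<in> U n \<Longrightarrow> y \<in> V n \<Longrightarrow> g (x, y) > 2 * e / 3"
    "\<And>x y. x \<in> W n \<Longrightarrow> y \<in> V n \<Longrightarrow> g (x, y) < e / 3" for n
    using F(1)[of n] by (auto simp: P_def U_def V_def W_def split: prod.splits)
  have FQ: "U (Suc n) \<subseteq> W n" "W (Suc n) \<subseteq> W n" for n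
    using F(2)[of n] by (auto simp: Q_def U_def V_def W_def split: prod.splits)
  have mono: "W m \<subseteq> W n" if "n \<le> m" for n m
    using lift_Suc_antimono_le[of W] FQ(2) that by blast
  have UW: "U m \<subseteq> W n" if less: "n < m" for n m
  proof -
    obtain k where "m = Suc k" "n \<le> k" using less by (cases m) auto
    then show ?thesis using FQ(1) mono by blast
  qed
  obtain z where z: "z \<in> topspace (prod_topology X Y)" and cluster:
    "\<And>O'. openin (prod_topology X Y) O' \<Longrightarrow> z \<in> O' \<Longrightarrow>
        \<exists>n m. n < m \<and> (U n \<times> V n) \<inter> O' \<noteq> {} \<and> (U m \<times> V m) \<inter> O' \<noteq> {}"
  proof (rule pseudocompact_no_discrete_open_sequence[OF assms(1,2), of "\<lambda>n. U n \<times> V n"])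
    show "openin (prod_topology X Y) (U n \<times> V n)" "U n \<times> V n \<noteq> {}" for n
      using FP(1-4) by (auto simp: openin_prod_Times_iff)
  qed blast
  obtain zx zy where zz: "z = (zx, zy)" "zx \<in> topspace X" "zy \<in> topspace Y" using z by (cases z) auto
  obtain A B where AB: "openin X A" "openin Y B" "zx \<in> A" "zy \<in> B"
      "\<And>x' y'. x' \<in> A \<Longrightarrow> y' \<in> B \<Longrightarrow> \<bar>g (x', y') - g (zx, zy)\<bar> < e / 6"
    using continuous_map_prod_real_nbhd[OF g zz(2,3), of "e / 6"] e by (metis divide_pos_pos zero_less_numeral)
  obtain n m where nm: "n < m" "(U n \<times> V n) \<inter> (A \<times> B) \<noteq> {}" "(U m \<times> V m) \<inter> (A \<times> B) \<noteq> {}"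
    using cluster[of "A \<times> B"] AB zz by (auto simp: openin_prod_Times_iff)
  \<comment> \<open>Both \<open>(a, b)\<close> and \<open>(a', b)\<close> lie in
    \<open>A \<times> B\<close>, so their \<open>g\<close>-values are within \<open>e / 6\<close> of
    the value at \<open>z\<close>. But the first lies in box \<open>n\<close>, and \<open>a'\<close>
    comes from a later \<open>U m\<close>, hence from \<open>W n\<close>, so the values differ by
    more than \<open>e / 3\<close>.\<close>
  then obtain a b a' where ab: "a \<in> U n" "b \<in> V n" "a \<in> A" "b \<in> B" "a' \<in> U m" "a' \<in> A" by auto
  have "g (a, b) > 2 * e / 3" using FP(5) ab by blast
  moreover have "g (a', b) < e / 3" using FP(6)[of a' n b] UW[OF nm(1)] ab by blast
  ultimately show False using AB(5)[OF ab(3,4)] AB(5)[OF ab(6,4)] by linarith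
qed

text \<open>Otherwise a greedy choice gives points \<open>x n\<close> whose sections are pairwise
  more than \<open>e\<close> apart in the supremum sense. By equicontinuity each has a neighbourhood
  \<open>U n\<close> with variation below \<open>e / 4\<close>. Two of the strips
  \<open>U n \<times> topspace Y\<close> come close to a common point, and four steps of
  \<open>e / 4\<close> join their sections.\<close>

lemma pseudocompact_prod_totally_bounded_sections:
  fixes f :: "'a \<times> 'b \<Rightarrow> real"
  assumes "pseudocompact_space (prod_topology X Y)" "completely_regular_space (prod_topology X Y)"
    and f: "continuous_map (prod_topology X Y) euclideanreal f"
    and Y: "topspace Y \<noteq> {}" and e: "e > 0"
  obtains K where "finite K" "K \<subseteq> topspace X"
    "\<And>x. x \<in> topspace X \<Longrightarrow> \<exists>k\<in>K. \<forall>y\<in>topspace Y. \<bar>f (x, y) - f (k, y)\<bar> \<le> e"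
proof (rule ccontr)
  assume neg: "\<not> thesis"
  define C where "C x k \<longleftrightarrow> (\<forall>y\<in>topspace Y. \<bar>f (x, y) - f (k, y)\<bar> \<le> e)" for x k
  have "\<exists>x. \<forall>n::nat. x n \<in> topspace X \<and> (\<forall>m<n. \<not> C (x n) (x m))"
  proof (rule dependent_wellorder_choice)
    fix n :: nat and x :: "nat \<Rightarrow> 'a"
    assume "\<And>m. m < n \<Longrightarrow> x m \<in> topspace X \<and> (\<forall>k<m. \<not> C (x m) (x k))"
    then have "finite (x ` {..<n})" "x ` {..<n} \<subseteq> topspace X" by auto
    then show "\<exists>r. r \<in> topspace X \<and> (\<forall>m<n. \<not> C r (x m))"
      using neg that[of "x ` {..<n}"] unfolding C_def by blast
  qed auto
  then obtain x where x: "\<And>n::nat. x n \<in> topspace X" "\<And>n m. m < n \<Longrightarrow> \<not> C (x n) (x m)" by blast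
  have equi: "\<exists>U. openin X U \<and> p \<in> U \<and> (\<forall>q\<in>U. \<forall>y\<in>topspace Y. \<bar>f (q, y) - f (p, y)\<bar> < e / 4)"
    if "p \<in> topspace X" for p
    by (metis pseudocompact_prod_equicontinuous_sections[OF assms(1-3) that, of "e / 4"] e divide_pos_pos zero_less_numeral)
  obtain U where U: "\<And>n. openin X (U n)" "\<And>n. x n \<in> U n"
    "\<And>n q y. q \<in> U n \<Longrightarrow> y \<in> topspace Y \<Longrightarrow> \<bar>f (q, y) - f (x n, y)\<bar> < e / 4"
    using equi[OF x(1)] by metis
  obtain z where z: "z \<in> topspace (prod_topology X Y)" and cluster:
    "\<And>O'. openin (prod_topology X Y) O' \<Longrightarrow> z \<in> O' \<Longrightarrow>
        \<exists>n m. n < m \<and> (U n \<times> topspace Y) \<inter> O' \<noteq> {} \<and> (U m \<times> topspace Y) \<inter> O' \<noteq> {}"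
  proof (rule pseudocompact_no_discrete_open_sequence[OF assms(1,2), of "\<lambda>n. U n \<times> topspace Y"])
    show "openin (prod_topology X Y) (U n \<times> topspace Y)" for n
      using U(1) by (simp add: openin_prod_Times_iff)
    show "U n \<times> topspace Y \<noteq> {}" for n using U(2)[of n] Y by blast
  qed blast
  have zX: "fst z \<in> topspace X" "snd z \<in> topspace Y" using z by auto
  obtain A where A: "openin X A" "fst z \<in> A"
      "\<And>q y. q \<in> A \<Longrightarrow> y \<in> topspace Y \<Longrightarrow> \<bar>f (q, y) - f (fst z, y)\<bar> < e / 4"
    using equi[OF zX(1)] by metis
  have "z \<in> A \<times> topspace Y" using A(2) zX by (cases z) auto
  then obtain n m where nm: "n < m" "U n \<inter> A \<noteq> {}" "U m \<inter> A \<noteq> {}"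
    using cluster[of "A \<times> topspace Y"] A(1) by (auto simp: openin_prod_Times_iff)
  then obtain a b where ab: "a \<in> U n" "a \<in> A" "b \<in> U m" "b \<in> A" by blast
  have "C (x m) (x n)" unfolding C_def
  proof
    fix y assume y: "y \<in> topspace Y"
    show "\<bar>f (x m, y) - f (x n, y)\<bar> \<le> e"
      using U(3)[OF ab(1) y] U(3)[OF ab(3) y] A(3)[OF ab(2) y] A(3)[OF ab(4) y] by linarith
  qed
  with x(2)[OF nm(1)] show False by blast
qed

section \<open>Averages with independent signs\<close>

text \<open>Rademacher signs on a finite cube: as \<open>a\<close> runs below \<open>2 ^ n\<close>,
  the signs at positions below \<open>n\<close> run through every pattern exactly once, so sign
  patterns are enumerated by binary digits.\<close>

definition bit_sign :: "nat \<Rightarrow> nat \<Rightarrow> real"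
  where "bit_sign a i = (if bit a i then 1 else -1)"

lemma bit_sign_square [simp]: "bit_sign a i * bit_sign a i = 1"
  and abs_bit_sign [simp]: "\<bar>bit_sign a i\<bar> = 1"
  by (auto simp: bit_sign_def)

lemma bit_sign_add_power:
  assumes "i < n"
  shows "bit_sign (a + 2 ^ n) i = bit_sign a i"
proof -
  have "(2::nat) ^ n = 2 ^ i * (2 * 2 ^ (n - Suc i))"
    using assms by (metis Suc_diff_Suc power_Suc power_add less_imp_le_nat add_diff_inverse_nat not_less)
  then show ?thesis by (simp add: bit_sign_def bit_iff_odd)
qed

lemma bit_sign_top:
  assumes "a < 2 ^ n"
  shows "bit_sign a n = -1" "bit_sign (a + 2 ^ n) n = 1"
  using assms by (auto simp: bit_sign_def bit_iff_odd)

lemma sum_lessThan_double: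
  fixes F :: "nat \<Rightarrow> real"
  shows "(\<Sum>a<2 ^ Suc n. F a) = (\<Sum>a<2 ^ n. F a + F (a + 2 ^ n))"
proof -
  have "(\<Sum>a<2 ^ Suc n. F a) = (\<Sum>a<2 ^ n. F a) + (\<Sum>a=2 ^ n..<2 ^ n + 2 ^ n. F a)"
    by (simp add: lessThan_atLeast0 sum.atLeastLessThan_concat mult_2)
  also have "(\<Sum>a=2 ^ n..<2 ^ n + 2 ^ n. F a) = (\<Sum>a<2 ^ n. F (a + 2 ^ n))"
    using sum.shift_bounds_nat_ivl[of F 0 "2 ^ n" "2 ^ n"] by (simp add: lessThan_atLeast0)
  finally show ?thesis by (simp add: sum.distrib)
qed

text \<open>By induction, pairing the numbers that differ only in bit \<open>n\<close>: the new
  coordinate enters once with each sign, and the cross terms of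
  \<open>(t - c)\<^sup>2 + (t + c)\<^sup>2\<close> cancel.\<close>

lemma bit_sign_orthogonality:
  fixes c :: "nat \<Rightarrow> real"
  shows "(\<Sum>a<2 ^ n. (\<Sum>i<n. bit_sign a i * c i)\<^sup>2) = 2 ^ n * (\<Sum>i<n. (c i)\<^sup>2)"
proof (induction n)
  case (Suc n)
  define t where "t a = (\<Sum>i<n. bit_sign a i * c i)" for a
  have "(\<Sum>a<2 ^ Suc n. (\<Sum>i<Suc n. bit_sign a i * c i)\<^sup>2)
      = (\<Sum>a<2 ^ n. (t a - c n)\<^sup>2 + (t a + c n)\<^sup>2)"
    unfolding sum_lessThan_double
    by (intro sum.cong) (simp_all add: t_def bit_sign_top bit_sign_add_power)
  also have "\<dots> = (\<Sum>a<2 ^ n. 2 * (t a)\<^sup>2 + 2 * (c n)\<^sup>2)"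
    by (intro sum.cong) (simp_all add: power2_eq_square algebra_simps)
  also have "\<dots> = 2 * (2 ^ n * (\<Sum>i<n. (c i)\<^sup>2)) + 2 ^ n * (2 * (c n)\<^sup>2)"
    using Suc by (simp add: sum.distrib t_def flip: sum_distrib_left)
  finally show ?case by (simp add: algebra_simps)
qed simp

text \<open>Cauchy-Schwarz over the \<open>2 ^ n\<close> rows, then orthogonality. Compared with the
  trivial bound \<open>2 ^ n * (n * M)\<close> this saves a factor \<open>sqrt n\<close>, which
  makes the averages vanish in the limit.\<close>

lemma sum_abs_bit_sign_le:
  fixes c :: "nat \<Rightarrow> real"
  assumes "\<And>i. \<bar>c i\<bar> \<le> M"
  shows "(\<Sum>a<2 ^ n. \<bar>\<Sum>i<n. bit_sign a i * c i\<bar>) \<le> 2 ^ n * (sqrt n * M)"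
proof (rule power2_le_imp_le)
  have M: "M \<ge> 0" using assms[of 0] by linarith
  then show "0 \<le> 2 ^ n * (sqrt n * M)" by simp
  have "(\<Sum>a<2 ^ n. \<bar>\<Sum>i<n. bit_sign a i * c i\<bar>)\<^sup>2
      \<le> (\<Sum>a<2 ^ n. \<bar>\<Sum>i<n. bit_sign a i * c i\<bar>\<^sup>2) * card {..<2 ^ n :: nat}"
    by (rule sum_squared_le_sum_of_squares)
  also have "\<dots> = 2 ^ n * 2 ^ n * (\<Sum>i<n. (c i)\<^sup>2)"
    by (simp add: bit_sign_orthogonality)
  also have "(\<Sum>i<n. (c i)\<^sup>2) \<le> (\<Sum>i<n. M\<^sup>2)"
    using assms by (intro sum_mono) (metis abs_ge_zero power2_abs power_mono)
  finally show "(\<Sum>a<2 ^ n. \<bar>\<Sum>i<n. bit_sign a i * c i\<bar>)\<^sup>2 \<le> (2 ^ n * (sqrt n * M))\<^sup>2"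
    by (simp add: power_mult_distrib power2_eq_square[of "2 ^ n"] mult_ac)
qed

lemma sign_average_tendsto_0:
  fixes F :: "nat \<Rightarrow> nat \<Rightarrow> real"
  assumes tb: "\<And>e. e > 0 \<Longrightarrow> \<exists>K. finite K \<and> (\<forall>c\<in>K. \<forall>i. \<bar>c i\<bar> \<le> M) \<and> (\<forall>k. \<exists>c\<in>K. \<forall>i. \<bar>F k i - c i\<bar> \<le> e)"
  shows "(\<lambda>n. (\<Sum>a<2 ^ n. \<Sum>i<n. bit_sign a i * F (2 ^ n + a) i) / (real n * 2 ^ n)) \<longlonglongrightarrow> 0"
proof (rule LIMSEQ_I)
  fix r :: real assume r: "r > 0"
  obtain K where K: "finite K" "\<And>c i. c \<in> K \<Longrightarrow> \<bar>c i\<bar> \<le> M"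
      "\<And>k. \<exists>c\<in>K. \<forall>i. \<bar>F k i - c i\<bar> \<le> r / 2"
    using tb[of "r / 2"] r by auto
  have bound: "\<bar>(\<Sum>a<2 ^ n. \<Sum>i<n. bit_sign a i * F (2 ^ n + a) i) / (real n * 2 ^ n)\<bar>
      \<le> r / 2 + card K * M / sqrt n" if n: "n > 0" for n
  proof -
    \<comment> \<open>The approximating \<open>c\<close> varies with \<open>k\<close>, and
      \<open>k\<close> varies with the row. Summing over all of \<open>K\<close> removes this
      dependence, so that the rows can be summed for each fixed \<open>c\<close>; the price is the
      harmless factor \<open>card K\<close>.\<close>
    have row: "\<bar>\<Sum>i<n. bit_sign a i * F k i\<bar> \<le> (\<Sum>c\<in>K. \<bar>\<Sum>i<n. bit_sign a i * c i\<bar>) + n * (r / 2)" for a k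
    proof -
      obtain c where c: "c \<in> K" "\<And>i. \<bar>F k i - c i\<bar> \<le> r / 2" using K(3) by blast
      have "(\<Sum>i<n. bit_sign a i * F k i) = (\<Sum>i<n. bit_sign a i * c i) + (\<Sum>i<n. bit_sign a i * (F k i - c i))"
        by (simp add: algebra_simps flip: sum.distrib)
      moreover have "\<bar>\<Sum>i<n. bit_sign a i * (F k i - c i)\<bar> \<le> (\<Sum>i<n. r / 2)"
        by (rule order_trans[OF sum_abs sum_mono]) (simp only: abs_mult abs_bit_sign mult_1 c)
      moreover have "\<bar>\<Sum>i<n. bit_sign a i * c i\<bar> \<le> (\<Sum>c\<in>K. \<bar>\<Sum>i<n. bit_sign a i * c i\<bar>)"
        using member_le_sum[OF c(1), of "\<lambda>c. \<bar>\<Sum>i<n. bit_sign a i * c i\<bar>"] K(1) by simp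
      ultimately show ?thesis by simp
    qed
    have "\<bar>\<Sum>a<2 ^ n. \<Sum>i<n. bit_sign a i * F (2 ^ n + a) i\<bar>
        \<le> (\<Sum>a<2 ^ n. (\<Sum>c\<in>K. \<bar>\<Sum>i<n. bit_sign a i * c i\<bar>) + n * (r / 2))"
      by (rule order_trans[OF sum_abs sum_mono]) (rule row)
    also have "\<dots> = (\<Sum>c\<in>K. \<Sum>a<2 ^ n. \<bar>\<Sum>i<n. bit_sign a i * c i\<bar>) + 2 ^ n * (n * (r / 2))"
      by (simp add: sum.distrib) (rule sum.swap)
    also have "(\<Sum>c\<in>K. \<Sum>a<2 ^ n. \<bar>\<Sum>i<n. bit_sign a i * c i\<bar>) \<le> (\<Sum>c\<in>K. 2 ^ n * (sqrt n * M))"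
      by (intro sum_mono sum_abs_bit_sign_le K(2))
    finally have "\<bar>\<Sum>a<2 ^ n. \<Sum>i<n. bit_sign a i * F (2 ^ n + a) i\<bar>
       \<le> card K * (2 ^ n * (sqrt n * M)) + 2 ^ n * (n * (r / 2))" by simp
    then have "\<bar>\<Sum>a<2 ^ n. \<Sum>i<n. bit_sign a i * F (2 ^ n + a) i\<bar> / (real n * 2 ^ n)
       \<le> (card K * (2 ^ n * (sqrt n * M)) + 2 ^ n * (n * (r / 2))) / (real n * 2 ^ n)"
      by (rule divide_right_mono) simp
    also have "\<dots> = r / 2 + card K * M * (sqrt n / n)"
      using n by (simp add: field_simps)
    also have "sqrt n / n = 1 / sqrt n"
      using n by (simp add: field_simps flip: real_sqrt_mult)
    finally show ?thesis by (simp add: abs_mult)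
  qed
  have "(\<lambda>n. card K * M / sqrt (real n)) \<longlonglongrightarrow> 0"
    by (intro tendsto_divide_0[OF tendsto_const] filterlim_at_top_imp_at_infinity
        filterlim_compose[OF sqrt_at_top filterlim_real_sequentially])
  then have "\<forall>\<^sub>F n in sequentially. card K * M / sqrt (real n) < r / 2"
    using r by (intro order_tendstoD(2)) auto
  then have "\<forall>\<^sub>F n in sequentially. norm ((\<Sum>a<2 ^ n. \<Sum>i<n. bit_sign a i * F (2 ^ n + a) i) / (real n * 2 ^ n) - 0) < r"
    using eventually_gt_at_top[of 0]
  proof eventually_elim
    case (elim n)
    then show ?case unfolding real_norm_def diff_0_right using bound[OF elim(2)] by linarith
  qed
  then show "\<exists>no. \<forall>n\<ge>no. norm ((\<Sum>a<2 ^ n. \<Sum>i<n. bit_sign a i * F (2 ^ n + a) i) / (real n * 2 ^ n) - 0) < r"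
    by (simp add: eventually_sequentially)
qed

section \<open>Complemented copies\<close>

text \<open>Since \<open>T\<close> is a left inverse of \<open>S\<close>, the map
  \<open>S \<circ> T\<close> is idempotent with the same image as \<open>S\<close>; this image is
  the copy, with \<open>T\<close> and \<open>S\<close> as inverse homeomorphisms.\<close>

lemma contains_complemented_copyI:
  fixes E :: "'a::real_vector topology" and F :: "'b::real_vector topology"
  assumes E: "subspace (topspace E)" and F: "subspace (topspace F)"
    and T: "linear_map_on (topspace E) T" "continuous_map E F T"
    and S: "linear_map_on (topspace F) S" "continuous_map F E S"
    and TS: "\<And>v. v \<in> topspace F \<Longrightarrow> T (S v) = v"
  shows "contains_complemented_copy E F"
proof -
  define Z where "Z = S ` topspace F"
  have SE: "S v \<in> topspace E" if "v \<in> topspace F" for v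
    using S(2) that by (auto simp: continuous_map_def)
  have TF: "T v \<in> topspace F" if "v \<in> topspace E" for v
    using T(2) that by (auto simp: continuous_map_def)
  have ZE: "Z \<subseteq> topspace E" using SE by (auto simp: Z_def)
  have "subspace Z"
    unfolding subspace_def
  proof (intro conjI ballI allI)
    have "S (0 *\<^sub>R 0) = 0 *\<^sub>R S 0"
      using S(1) subspace_0[OF F] unfolding linear_map_on_def by blast
    then have "S 0 = 0" by simp
    then show "0 \<in> Z" using subspace_0[OF F] unfolding Z_def by (metis imageI)
  next
    fix x y assume "x \<in> Z" "y \<in> Z"
    then obtain u v where "u \<in> topspace F" "v \<in> topspace F" "x = S u" "y = S v" by (auto simp: Z_def)
    then show "x + y \<in> Z" using S(1) subspace_add[OF F] unfolding Z_def linear_map_on_def by (metis imageI)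
  next
    fix c x assume "x \<in> Z"
    then obtain u where "u \<in> topspace F" "x = S u" by (auto simp: Z_def)
    then show "c *\<^sub>R x \<in> Z" using S(1) subspace_scale[OF F] unfolding Z_def linear_map_on_def by (metis imageI)
  qed
  moreover have "linearly_homeomorphic (subtopology E Z) F"
  proof -
    have top: "topspace (subtopology E Z) = Z" using ZE by auto
    have "homeomorphic_maps (subtopology E Z) F T S"
      unfolding homeomorphic_maps_def top
      using T(2) S(2) TS by (auto simp: Z_def continuous_map_in_subtopology continuous_map_from_subtopology)
    moreover have "linear_map_on Z T" using T(1) ZE unfolding linear_map_on_def by blast
    ultimately show ?thesis unfolding linearly_homeomorphic_def top homeomorphic_maps_map by blast
  qed
  moreover have "continuous_linear_projection E Z (S \<circ> T)"
    unfolding continuous_linear_projection_def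
  proof (intro conjI ballI)
    show "linear_map_on (topspace E) (S \<circ> T)"
      using T(1) S(1) TF unfolding linear_map_on_def by simp
    show "continuous_map E E (S \<circ> T)" using T(2) S(2) by (rule continuous_map_compose)
    show "(S \<circ> T) ` topspace E = Z"
    proof
      show "(S \<circ> T) ` topspace E \<subseteq> Z" using TF by (auto simp: Z_def)
      show "Z \<subseteq> (S \<circ> T) ` topspace E"
      proof
        fix z assume "z \<in> Z"
        then obtain v where v: "v \<in> topspace F" "z = S v" by (auto simp: Z_def)
        then have "z = (S \<circ> T) (S v)" using TS by simp
        then show "z \<in> (S \<circ> T) ` topspace E" using SE v by blast
      qed
    qed
    show "(S \<circ> T) ((S \<circ> T) x) = (S \<circ> T) x" if "x \<in> topspace E" for x
      using TS TF that by simp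
  qed
  ultimately show ?thesis using ZE unfolding contains_complemented_copy_def by blast
qed

text \<open>The common frame for both cases: \<open>T\<close> lists the coefficients \<mu>_n(f), and
  \<open>V\<close> is the space of coefficient sequences that give continuous sums, namely all
  sequences or the null sequences.\<close>

lemma Cp_contains_complemented_copyI:
  fixes Z :: "'a topology" and g :: "nat \<Rightarrow> 'a \<Rightarrow> real" and T :: "('a \<Rightarrow> real) \<Rightarrow> nat \<Rightarrow> real"
  assumes V: "subspace V"
    and T_lin: "linear_map_on (topspace (Cp Z)) T"
    and T_cont: "\<And>n. continuous_map (Cp Z) euclideanreal (\<lambda>f. T f n)"
    and T_V: "\<And>f. continuous_map Z euclideanreal f \<Longrightarrow> T f \<in> V"
    and g0: "\<And>n z. z \<notin> topspace Z \<Longrightarrow> g n z = 0"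
    and disj: "\<And>n m z. g n z \<noteq> 0 \<Longrightarrow> g m z \<noteq> 0 \<Longrightarrow> n = m"
    and cont: "\<And>v. v \<in> V \<Longrightarrow> continuous_map Z euclideanreal (\<lambda>z. \<Sum>n. v n * g n z)"
    and TS: "\<And>v. v \<in> V \<Longrightarrow> T (\<lambda>z. \<Sum>n. v n * g n z) = v"
  shows "contains_complemented_copy (Cp Z) (subtopology Romega V)"
proof (rule contains_complemented_copyI[where T = T and S = "\<lambda>v z. \<Sum>n. v n * g n z"])
  have ex: "\<exists>k. \<forall>v::nat \<Rightarrow> real. (\<Sum>n. v n * g n z) = v k * g k z" for z
    by (metis suminf_disjoint_eq[of "\<lambda>n. g n z"] disj)
  have topV: "topspace (subtopology Romega V) = V" by simp
  show "subspace (topspace (Cp Z))" by (rule subspace_topspace_Cp)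
  show "subspace (topspace (subtopology Romega V))" using V by simp
  show "linear_map_on (topspace (Cp Z)) T" by (rule T_lin)
  show "continuous_map (Cp Z) (subtopology Romega V) T"
    using T_cont T_V by (auto simp: continuous_map_in_subtopology continuous_map_componentwise_UNIV topspace_Cp)
  show "linear_map_on (topspace (subtopology Romega V)) (\<lambda>v z. \<Sum>n. v n * g n z)"
    unfolding linear_map_on_def
  proof (intro conjI ballI allI ext)
    fix u v :: "nat \<Rightarrow> real" and z
    obtain k where k: "\<And>v::nat \<Rightarrow> real. (\<Sum>n. v n * g n z) = v k * g k z" using ex by blast
    show "(\<Sum>n. (u + v) n * g n z) = ((\<lambda>z. \<Sum>n. u n * g n z) + (\<lambda>z. \<Sum>n. v n * g n z)) z"
      using k[of "u + v"] by (simp add: k distrib_right)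
  next
    fix c :: real and v :: "nat \<Rightarrow> real" and z
    obtain k where "\<And>v::nat \<Rightarrow> real. (\<Sum>n. v n * g n z) = v k * g k z" using ex by blast
    then show "(\<Sum>n. (c *\<^sub>R v) n * g n z) = (c *\<^sub>R (\<lambda>z. \<Sum>n. v n * g n z)) z"
      by simp
  qed
  show "continuous_map (subtopology Romega V) (Cp Z) (\<lambda>v z. \<Sum>n. v n * g n z)"
    unfolding Cp_def continuous_map_in_subtopology
  proof
    show "continuous_map (subtopology Romega V) (powertop_real UNIV) (\<lambda>v z. \<Sum>n. v n * g n z)"
      unfolding continuous_map_componentwise_UNIV
    proof
      fix z
      obtain k where "\<And>v::nat \<Rightarrow> real. (\<Sum>n. v n * g n z) = v k * g k z" using ex by blast
      then show "continuous_map (subtopology Romega V) euclideanreal (\<lambda>v. \<Sum>n. v n * g n z)"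
        by (auto intro!: continuous_map_real_mult_right continuous_map_from_subtopology continuous_map_product_projection)
    qed
    show "(\<lambda>v z. \<Sum>n. v n * g n z) \<in> topspace (subtopology Romega V) \<rightarrow>
      {f. continuous_map Z euclideanreal f \<and> (\<forall>x. x \<notin> topspace Z \<longrightarrow> f x = 0)}"
      using cont g0 by auto
  qed
  show "T (\<lambda>z. \<Sum>n. v n * g n z) = v" if "v \<in> topspace (subtopology Romega V)" for v
    using TS that by simp
qed

section \<open>The non-pseudocompact case: a copy of R^omega\<close>

lemma continuous_map_Cp_eval: "continuous_map (Cp Z) euclideanreal (\<lambda>f. f z)"
  unfolding Cp_def by (auto intro: continuous_map_from_subtopology continuous_map_product_projection)

lemma not_pseudocompact_imp_complemented_Romega:
  assumes "\<not> pseudocompact_space Z"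
  shows "contains_complemented_copy (Cp Z) Romega"
proof -
  obtain f0 :: "'a \<Rightarrow> real" where f0: "continuous_map Z euclideanreal f0" "\<not> bounded (f0 ` topspace Z)"
    using assms by (auto simp: pseudocompact_space_def)
  define f where "f z = \<bar>f0 z\<bar>" for z
  have f: "continuous_map Z euclideanreal f" unfolding f_def using f0 by (intro continuous_intros)
  have unb: "\<exists>z\<in>topspace Z. f z > B" for B
    using f0(2) unfolding bounded_iff f_def by (auto simp: not_le)
  \<comment> \<open>The gap 2 is twice the radius of the bumps defined below in terms of the values
    of \<open>f\<close>, so their supports cannot overlap.\<close>
  have "\<exists>p. \<forall>n. p n \<in> topspace Z \<and> f (p (Suc n)) > f (p n) + 2"
    using dependent_nat_choice[of "\<lambda>_ p. p \<in> topspace Z" "\<lambda>_ p q. f q > f p + 2"] unb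
    by (metis)
  then obtain p where p: "\<And>n. p n \<in> topspace Z" "\<And>n. f (p (Suc n)) > f (p n) + 2" by blast
  have grow: "f (p m) \<ge> f (p n) + 2 * real (m - n)" if "n \<le> m" for n m
    using that
  proof (induction m rule: dec_induct)
    case (step k)
    then show ?case using p(2)[of k] by (simp add: Suc_diff_le)
  qed simp
  have sep: "\<bar>f (p n) - f (p m)\<bar> \<ge> 2" if "n \<noteq> m" for n m
  proof -
    have *: "f (p j) \<ge> f (p i) + 2" if "i < j" for i j
    proof -
      have "real (j - i) \<ge> 1" using that by simp
      then show ?thesis using grow[of i j] that by linarith
    qed
    show ?thesis using *[of n m] *[of m n] that by (cases n m rule: linorder_cases) auto
  qed
  define g where "g n z = (if z \<in> topspace Z then max 0 (1 - \<bar>f z - f (p n)\<bar>) else 0)" for n z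
  have g_cont: "continuous_map Z euclideanreal (g n)" for n
  proof (rule continuous_map_eq)
    show "continuous_map Z euclideanreal (\<lambda>z. max 0 (1 - \<bar>f z - f (p n)\<bar>))"
      using f by (intro continuous_intros) auto
  qed (simp add: g_def)
  have g_nz: "\<bar>f z - f (p n)\<bar> < 1" if "g n z \<noteq> 0" for n z
    using that by (auto simp: g_def max_def split: if_splits)
  have disj: "n = m" if "g n z \<noteq> 0" "g m z \<noteq> 0" for n m z
    using g_nz[OF that(1)] g_nz[OF that(2)] sep[of n m] by fastforce
  have val: "g n (p m) = (if n = m then 1 else 0)" for n m
    using disj[of n "p m" m] p(1) by (auto simp: g_def)
  have "contains_complemented_copy (Cp Z) (subtopology Romega UNIV)"
  proof (rule Cp_contains_complemented_copyI[where T = "\<lambda>f n. f (p n)" and g = g])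
    show "linear_map_on (topspace (Cp Z)) (\<lambda>f n. f (p n))"
      by (auto simp: linear_map_on_def plus_fun_def)
    show "continuous_map Z euclideanreal (\<lambda>z. \<Sum>n. v n * g n z)" for v :: "nat \<Rightarrow> real"
    proof (rule continuous_map_locally_uniform_limit)
      fix z and e :: real assume z: "z \<in> topspace Z" and e: "e > 0"
      obtain U where U: "openin Z U" "z \<in> U" "\<And>y. y \<in> U \<Longrightarrow> \<bar>f y - f z\<bar> < 1"
        using f z unfolding continuous_map_real_iff by (metis zero_less_one)
      \<comment> \<open>On \<open>U\<close> the function \<open>f\<close> stays below
        \<open>f z + 1\<close>, so a nonzero \<open>g n\<close> there forces
        \<open>f (p n) < f z + 2\<close>. As \<open>f (p n)\<close> is at least
        \<open>2 * n\<close>, only indices below \<open>N\<close> remain.\<close>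
      obtain N :: nat where N: "real N > f z + 2" using reals_Archimedean2 by blast
      have far: "g n y = 0" if "y \<in> U" "n \<notin> {..<N}" for n y
      proof (rule ccontr)
        assume "g n y \<noteq> 0"
        then have "f (p n) < f z + 2" using g_nz[of n y] U(3)[OF that(1)] by linarith
        moreover have "f (p n) \<ge> 2 * real n" using grow[of 0 n] f_def by simp
        ultimately show False using N that(2) by simp
      qed
      have "(\<Sum>n. v n * g n y) = (\<Sum>n<N. v n * g n y)" if "y \<in> U" for y
        using far[OF that] by (intro suminf_finite) auto
      then show "\<exists>U h. openin Z U \<and> z \<in> U \<and> continuous_map Z euclideanreal h \<and>
          (\<forall>y\<in>U. \<bar>(\<Sum>n. v n * g n y) - h y\<bar> \<le> e)"
        using U e by (intro exI[of _ U] exI[of _ "\<lambda>y. \<Sum>n<N. v n * g n y"])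
          (auto intro!: continuous_map_sum continuous_map_real_mult_left g_cont)
    qed
    show "(\<lambda>m. \<Sum>n. v n * g n (p m)) = v" for v :: "nat \<Rightarrow> real"
      by (rule ext, subst suminf_eq_single) (auto simp: val)
  qed (auto simp: g_def continuous_map_Cp_eval intro: disj)
  then show ?thesis by simp
qed

section \<open>The pseudocompact case: a copy of (c_0)_p\<close>

lemma sum_disjoint_le_1:
  fixes h :: "'i \<Rightarrow> real"
  assumes "finite A" "\<And>k. h k \<le> 1" "\<And>k l. k \<in> A \<Longrightarrow> l \<in> A \<Longrightarrow> h k \<noteq> 0 \<Longrightarrow> h l \<noteq> 0 \<Longrightarrow> k = l"
  shows "sum h A \<le> 1"
proof (cases "\<exists>k\<in>A. h k \<noteq> 0")
  case True
  then obtain k where k: "k \<in> A" "h k \<noteq> 0" by blast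
  have "sum h A = sum h {k}"
    using k assms by (intro sum.mono_neutral_right) auto
  then show ?thesis using assms by simp
qed (simp add: sum.neutral)

text \<open>The dyadic blocks from \<open>2 ^ n\<close> up to \<open>2 ^ Suc n\<close> are disjoint,
  so different averages use different points of \<open>X\<close>.\<close>

lemma power_block_unique:
  fixes a b :: nat
  assumes "2 ^ n + a = 2 ^ m + b" "a < 2 ^ n" "b < 2 ^ m"
  shows "n = m"
proof -
  have *: "\<not> i < j" if "2 ^ i + a' = (2::nat) ^ j + b'" "a' < 2 ^ i" for i j a' b' :: nat
  proof
    assume "i < j"
    then have "(2::nat) ^ Suc i \<le> 2 ^ j" by (intro power_increasing) auto
    then show False using that by simp
  qed
  show ?thesis using *[of n a m b] *[of m b n a] assms by force
qed

text \<open>At each point at most one term is nonzero, so the tail from \<open>N\<close> on is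
  bounded by the largest remaining coefficient. The partial sums therefore converge uniformly on all
  of \<open>Z\<close>.\<close>

lemma c0_combination_continuous:
  fixes g :: "nat \<Rightarrow> 'a \<Rightarrow> real"
  assumes g: "\<And>n. continuous_map Z euclideanreal (g n)" "\<And>n z. \<bar>g n z\<bar> \<le> 1"
    and disj: "\<And>n m z. g n z \<noteq> 0 \<Longrightarrow> g m z \<noteq> 0 \<Longrightarrow> n = m"
    and v: "v \<longlonglongrightarrow> 0"
  shows "continuous_map Z euclideanreal (\<lambda>z. \<Sum>n. v n * g n z)"
proof (rule continuous_map_locally_uniform_limit)
  fix z and e :: real assume z: "z \<in> topspace Z" and e: "e > 0"
  obtain N where N: "\<And>n. n \<ge> N \<Longrightarrow> \<bar>v n\<bar> < e" using LIMSEQ_D[OF v e] by auto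
  have "\<bar>(\<Sum>n. v n * g n y) - (\<Sum>n<N. v n * g n y)\<bar> \<le> e" for y
  proof -
    obtain k where k: "\<And>v :: nat \<Rightarrow> real. (\<Sum>n. v n * g n y) = v k * g k y" "\<And>n. n \<noteq> k \<Longrightarrow> g n y = 0"
      by (rule suminf_disjoint_eq[of "\<lambda>n. g n y"]) (use disj in blast)+
    show ?thesis
    proof (cases "k < N")
      case True
      then have "(\<Sum>n<N. v n * g n y) = (\<Sum>n\<in>{k}. v n * g n y)"
        using k(2) by (intro sum.mono_neutral_right) auto
      then show ?thesis using k(1) e by simp
    next
      case False
      then have "(\<Sum>n<N. v n * g n y) = 0" using k(2) by (intro sum.neutral) auto
      moreover have "\<bar>v k * g k y\<bar> \<le> e * 1"
        unfolding abs_mult using N[of k] False g(2)[of k y] e by (intro mult_mono) auto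
      ultimately show ?thesis using k(1) by simp
    qed
  qed
  then show "\<exists>U h. openin Z U \<and> z \<in> U \<and> continuous_map Z euclideanreal h \<and>
      (\<forall>y\<in>U. \<bar>(\<Sum>n. v n * g n y) - h y\<bar> \<le> e)"
    using z by (intro exI[of _ "topspace Z"] exI[of _ "\<lambda>y. \<Sum>n<N. v n * g n y"])
      (auto intro!: continuous_map_sum continuous_map_real_mult_left g)
qed

lemma pseudocompact_prod_imp_complemented_c0p:
  fixes X :: "'a topology" and Y :: "'b topology"
  assumes X: "Tychonoff_space X" "infinite (topspace X)"
    and Y: "Tychonoff_space Y" "infinite (topspace Y)"
    and pc: "pseudocompact_space (prod_topology X Y)"
  shows "contains_complemented_copy (Cp (prod_topology X Y)) c0p"
proof -
  let ?Z = "prod_topology X Y"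
  have cr: "completely_regular_space ?Z"
    using X Y by (simp add: Tychonoff_space_def completely_regular_space_prod_topology)
  obtain x \<phi> where x: "\<And>k::nat. x k \<in> topspace X" and \<phi>: "\<And>k. continuous_map X euclideanreal (\<phi> k)"
    "\<And>k. \<phi> k (x k) = 1" "\<And>k u. 0 \<le> \<phi> k u" "\<And>k u. \<phi> k u \<le> 1"
    "\<And>k u. u \<notin> topspace X \<Longrightarrow> \<phi> k u = 0"
    "\<And>k l u. \<phi> k u \<noteq> 0 \<Longrightarrow> \<phi> l u \<noteq> 0 \<Longrightarrow> k = l"
    using Tychonoff_bump_sequence[OF X] by metis
  obtain y \<psi> where y: "\<And>k::nat. y k \<in> topspace Y" and \<psi>: "\<And>k. continuous_map Y euclideanreal (\<psi> k)"
    "\<And>k. \<psi> k (y k) = 1" "\<And>k u. 0 \<le> \<psi> k u" "\<And>k u. \<psi> k u \<le> 1"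
    "\<And>k u. u \<notin> topspace Y \<Longrightarrow> \<psi> k u = 0"
    "\<And>k l u. \<psi> k u \<noteq> 0 \<Longrightarrow> \<psi> l u \<noteq> 0 \<Longrightarrow> k = l"
    using Tychonoff_bump_sequence[OF Y] by metis
  have \<phi>x: "\<phi> k (x l) = (if k = l then 1 else 0)" for k l using \<phi>(2) \<phi>(6)[of k "x l" l] by auto
  have \<psi>y: "\<psi> k (y l) = (if k = l then 1 else 0)" for k l using \<psi>(2) \<psi>(6)[of k "y l" l] by auto
  \<comment> \<open>The signed average over a grid of \<open>n * 2 ^ n\<close> points. The function
    \<open>h n\<close> below carries the same signs on bumps around these points, so pairing the two
    averages squares of signs.\<close>
  define A where "A f n = (\<Sum>a<2 ^ n. \<Sum>i<n. bit_sign a i * f (x (2 ^ n + a), y i)) / (real n * 2 ^ n)"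
    for f :: "'a \<times> 'b \<Rightarrow> real" and n :: nat
  define h where "h n z = (\<Sum>a<2 ^ n. \<Sum>i<n. bit_sign a i * (\<phi> (2 ^ n + a) (fst z) * \<psi> i (snd z)))"
    for n :: nat and z :: "'a \<times> 'b"
  have A_add: "A (f + g) n = A f n + A g n" for f g n
    by (simp add: A_def sum.distrib add_divide_distrib distrib_left)
  have A_scale: "A (c *\<^sub>R f) n = c * A f n" for c f n
    by (simp add: A_def sum_distrib_left mult.left_commute)
  have h_cont: "continuous_map ?Z euclideanreal (h n)" for n
    unfolding h_def
    using continuous_map_compose[OF continuous_map_fst \<phi>(1)] continuous_map_compose[OF continuous_map_snd \<psi>(1)]
    by (intro continuous_map_sum continuous_map_real_mult_left continuous_map_real_mult) (auto simp: o_def)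
  have h_nz: "\<exists>a<2 ^ n. \<phi> (2 ^ n + a) (fst z) \<noteq> 0" if "h n z \<noteq> 0" for n z
  proof (rule ccontr)
    assume "\<not> ?thesis"
    then have "h n z = 0" unfolding h_def by (intro sum.neutral ballI) auto
    with that show False by simp
  qed
  \<comment> \<open>The points \<open>y i\<close> are reused in every block; the supports are
    separated by the first coordinate alone.\<close>
  have h_disj: "n = m" if nz: "h n z \<noteq> 0" "h m z \<noteq> 0" for n m z
  proof -
    obtain a b where "a < 2 ^ n" "\<phi> (2 ^ n + a) (fst z) \<noteq> 0" "b < 2 ^ m" "\<phi> (2 ^ m + b) (fst z) \<noteq> 0"
      using h_nz[OF nz(1)] h_nz[OF nz(2)] by blast
    then show ?thesis using \<phi>(6) power_block_unique by blast
  qed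
  \<comment> \<open>In absolute value the double sum is at most a product of two sums, each with at
    most one nonzero term.\<close>
  have h_le: "\<bar>h n z\<bar> \<le> 1" for n z
  proof -
    have "\<bar>h n z\<bar> \<le> (\<Sum>a<2 ^ n. \<Sum>i<n. \<phi> (2 ^ n + a) (fst z) * \<psi> i (snd z))"
      unfolding h_def
      by (intro order_trans[OF sum_abs] sum_mono) (simp add: abs_mult \<phi>(3) \<psi>(3))
    also have "\<dots> = (\<Sum>a<2 ^ n. \<phi> (2 ^ n + a) (fst z)) * (\<Sum>i<n. \<psi> i (snd z))"
      by (simp add: sum_product)
    also have "\<dots> \<le> 1 * 1"
    proof (rule mult_mono)
      show "(\<Sum>a<2 ^ n. \<phi> (2 ^ n + a) (fst z)) \<le> 1"
        using \<phi>(4,6) by (intro sum_disjoint_le_1) (auto, metis add_left_cancel)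
      show "(\<Sum>i<n. \<psi> i (snd z)) \<le> 1"
        using \<psi>(4,6) by (intro sum_disjoint_le_1) auto
    qed (auto intro: sum_nonneg \<psi>(3))
    finally show ?thesis by simp
  qed
  have h_val: "h m (x (2 ^ n + a), y i) = (if m = n then bit_sign a i else 0)" if ai: "a < 2 ^ n" "i < n" for m n a i
  proof (cases "m = n")
    case True
    have "h n (x (2 ^ n + a), y i) = (\<Sum>b<2 ^ n. if b = a then (\<Sum>j<n. if j = i then bit_sign b j else 0) else 0)"
      unfolding h_def by (intro sum.cong) (auto simp: \<phi>x \<psi>y mult_delta_right intro: sum.neutral)
    then show ?thesis using True ai by simp
  next
    case False
    have "h m (x (2 ^ n + a), y i) = 0"
    proof (rule ccontr)
      assume "\<not> ?thesis"
      then obtain b where "b < 2 ^ m" "\<phi> (2 ^ m + b) (x (2 ^ n + a)) \<noteq> 0" using h_nz by fastforce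
      then have "2 ^ m + b = 2 ^ n + a" "b < 2 ^ m" by (auto simp: \<phi>x split: if_splits)
      then show False using False power_block_unique ai by blast
    qed
    with False show ?thesis by simp
  qed
  have h_0: "h n z = 0" if "z \<notin> topspace ?Z" for n z
    unfolding h_def using that \<phi>(5) \<psi>(5) by (cases z) (auto intro!: sum.neutral)
  have A_lim: "A f \<longlonglongrightarrow> 0" if f: "continuous_map ?Z euclideanreal f" for f
  proof -
    have "bounded (f ` topspace ?Z)" using pc f by (auto simp: pseudocompact_space_def)
    then obtain M where M: "\<And>z. z \<in> topspace ?Z \<Longrightarrow> \<bar>f z\<bar> \<le> M"
      unfolding bounded_iff by auto
    have "(\<lambda>n. (\<Sum>a<2 ^ n. \<Sum>i<n. bit_sign a i * (\<lambda>k i. f (x k, y i)) (2 ^ n + a) i) / (real n * 2 ^ n)) \<longlonglongrightarrow> 0"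
    proof (rule sign_average_tendsto_0)
      fix e :: real assume e: "e > 0"
      have "topspace Y \<noteq> {}" using Y by auto
      then obtain K where K: "finite K" "K \<subseteq> topspace X"
          "\<And>x. x \<in> topspace X \<Longrightarrow> \<exists>k\<in>K. \<forall>y\<in>topspace Y. \<bar>f (x, y) - f (k, y)\<bar> \<le> e"
        using pseudocompact_prod_totally_bounded_sections[OF pc cr f _ e] by metis
      \<comment> \<open>The sections over \<open>K\<close>, sampled along the sequence
        \<open>y\<close>, are the finite set of sequences needed for the sign averages.\<close>
      have "\<forall>k. \<exists>c\<in>(\<lambda>k i. f (k, y i)) ` K. \<forall>i. \<bar>f (x k, y i) - c i\<bar> \<le> e"
      proof
        fix k
        obtain q where "q \<in> K" "\<forall>y\<in>topspace Y. \<bar>f (x k, y) - f (q, y)\<bar> \<le> e" using K(3)[OF x] by blast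
        then show "\<exists>c\<in>(\<lambda>k i. f (k, y i)) ` K. \<forall>i. \<bar>f (x k, y i) - c i\<bar> \<le> e"
          using y by (intro bexI[of _ "\<lambda>i. f (q, y i)"]) auto
      qed
      then show "\<exists>K. finite K \<and> (\<forall>c\<in>K. \<forall>i. \<bar>c i\<bar> \<le> M) \<and> (\<forall>k. \<exists>c\<in>K. \<forall>i. \<bar>f (x k, y i) - c i\<bar> \<le> e)"
        using K(1,2) M y by (intro exI[of _ "(\<lambda>k i. f (k, y i)) ` K"]) auto
    qed
    then show ?thesis by (simp add: A_def[abs_def])
  qed
  \<comment> \<open>Blocks are indexed from \<open>1\<close>, as the weight \<open>1 / (n * 2 ^ n)\<close> is \<open>1 / 0 = 0\<close> for \<open>n = 0\<close>.\<close>
  show ?thesis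
    unfolding c0p_def
  proof (rule Cp_contains_complemented_copyI[where T = "\<lambda>f n. A f (Suc n)" and g = "\<lambda>n. h (Suc n)"])
    show "subspace {x :: nat \<Rightarrow> real. x \<longlonglongrightarrow> 0}" using subspace_topspace_c0p by (simp add: topspace_c0p)
    show "linear_map_on (topspace (Cp ?Z)) (\<lambda>f n. A f (Suc n))"
      unfolding linear_map_on_def by (auto simp: A_add A_scale fun_eq_iff)
    show "continuous_map (Cp ?Z) euclideanreal (\<lambda>f. A f (Suc n))" for n
      unfolding A_def
      by (intro continuous_map_real_divide continuous_map_sum continuous_map_real_mult_left continuous_map_Cp_eval) auto
    show "(\<lambda>n. A f (Suc n)) \<in> {x. x \<longlonglongrightarrow> 0}" if "continuous_map ?Z euclideanreal f" for f
      using LIMSEQ_Suc[OF A_lim[OF that]] by simp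
    show "h (Suc n) z = 0" if "z \<notin> topspace ?Z" for n z using h_0 that by blast
    show "n = m" if "h (Suc n) z \<noteq> 0" "h (Suc m) z \<noteq> 0" for n m z using h_disj that by blast
    show "continuous_map ?Z euclideanreal (\<lambda>z. \<Sum>n. v n * h (Suc n) z)" if "v \<in> {x. x \<longlonglongrightarrow> 0}" for v
    proof (rule c0_combination_continuous)
      show "n = m" if "h (Suc n) z \<noteq> 0" "h (Suc m) z \<noteq> 0" for n m z using h_disj that by blast
    qed (use that h_cont h_le in auto)
    show "(\<lambda>n. A (\<lambda>z. \<Sum>m. v m * h (Suc m) z) (Suc n)) = v" for v :: "nat \<Rightarrow> real"
    proof
      fix n
      \<comment> \<open>On the grid of block \<open>Suc n\<close> only the term \<open>m = n\<close>
        survives. Multiplying by the sign once more leaves the constant \<open>v n\<close>, whose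
        average over the grid is \<open>v n\<close>.\<close>
      have "(\<Sum>m. v m * h (Suc m) (x (2 ^ Suc n + a), y i)) = v n * bit_sign a i"
        if "a < 2 ^ Suc n" "i < Suc n" for a i
        using h_val[OF that] by (subst suminf_eq_single[of n]) auto
      then have "A (\<lambda>z. \<Sum>m. v m * h (Suc m) z) (Suc n)
        = (\<Sum>a<2 ^ Suc n. \<Sum>i<Suc n. bit_sign a i * (v n * bit_sign a i)) / (real (Suc n) * 2 ^ Suc n)"
        unfolding A_def by (intro arg_cong2[where f = "(/)"] sum.cong) auto
      also have "\<dots> = (\<Sum>a<(2::nat) ^ Suc n. \<Sum>i<Suc n. v n) / (real (Suc n) * 2 ^ Suc n)"
        by (simp only: mult.left_commute bit_sign_square mult_1_right)
      also have "\<dots> = v n" by (simp add: mult.left_commute[of _ "v n"] del: of_nat_Suc power_Suc)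
      finally show "A (\<lambda>z. \<Sum>m. v m * h (Suc m) z) (Suc n) = v n" .
    qed
  qed
qed

theorem theorem1p4:
  fixes X :: "'a topology" and Y :: "'b topology"
  assumes "Tychonoff_space X" and "infinite (topspace X)"
    and "Tychonoff_space Y" and "infinite (topspace Y)"
  shows "(pseudocompact_space (prod_topology X Y) \<longrightarrow>
            contains_complemented_copy (Cp (prod_topology X Y)) c0p) \<and>
         (\<not> pseudocompact_space (prod_topology X Y) \<longrightarrow>
            contains_complemented_copy (Cp (prod_topology X Y)) Romega)"
  using pseudocompact_prod_imp_complemented_c0p[OF assms] not_pseudocompact_imp_complemented_Romega by blast

end
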